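(* For all $m\ge 2$, the real Lie algebra $\mathfrak{sl}(2m-1,\mathbb{R})$ admits a non-regular complex structure.
   Context: Let $\mathfrak g_0$ be a real reductive Lie algebra of even dimension, $\mathfrak g=\mathfrak g_0\otimes\mathbb{C}$ its complexification and $\sigma$ the complex conjugation of $\mathfrak g$ with respect to $\mathfrak g_0$. A complex structure on $\mathfrak g_0$ is identified with a complex subalgebra $\mathfrak q$ of $\mathfrak g$ such that $\mathfrak g=\mathfrak q\oplus\sigma(\mathfrak q)$. Given a Cartan subalgebra $\mathfrak h$ of $\mathfrak g$, the complex structure $\mathfrak q$ is called $\mathfrak h$-regular if $[\mathfrak h,\mathfrak q]\subset\mathfrak q$ and $\mathfrak h=(\mathfrak h\cap\mathfrak q)+\sigma(\mathfrak h\cap\mathfrak q)$. It is called non-regular if there is no Cartan subalgebra $\mathfrak h$ of $\mathfrak g$ such that $\mathfrak q$ is $\mathfrak h$-regular. *)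

theory Defs
  imports Complex_Main "Jordan_Normal_Form.VS_Connect"
begin

text \<open>
  A Lie algebra is given by its carrier, a set of square matrices of a fixed size \<open>n\<close>, with the
  commutator as bracket.  For a real Lie algebra of real matrices the complexification and
  its conjugation are then realised inside the complex matrices of the same size.
\<close>

abbreviation matrix_subspace :: "nat \<Rightarrow> 'a::field mat set \<Rightarrow> bool" where
  "matrix_subspace n W \<equiv> VectorSpace.subspace (class_ring :: 'a ring) W (module_mat TYPE('a) n n)"

abbreviation matrix_span :: "nat \<Rightarrow> 'a::field mat set \<Rightarrow> 'a mat set" where
  "matrix_span n S \<equiv> LinearCombinations.module.span (class_ring :: 'a ring) (module_mat TYPE('a) n n) S"

definition lie_bracket :: "'a::field mat \<Rightarrow> 'a mat \<Rightarrow> 'a mat" where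
  "lie_bracket A B = A * B - B * A"

definition matrix_lie_algebra :: "nat \<Rightarrow> 'a::field mat set \<Rightarrow> bool" where
  "matrix_lie_algebra n L \<longleftrightarrow>
     matrix_subspace n L \<and> (\<forall>A\<in>L. \<forall>B\<in>L. lie_bracket A B \<in> L)"

definition lie_subalgebra :: "nat \<Rightarrow> 'a::field mat set \<Rightarrow> 'a mat set \<Rightarrow> bool" where
  "lie_subalgebra n L M \<longleftrightarrow> matrix_lie_algebra n M \<and> M \<subseteq> L"

definition set_bracket :: "nat \<Rightarrow> 'a::field mat set \<Rightarrow> 'a mat set \<Rightarrow> 'a mat set" where
  "set_bracket n S T = matrix_span n {lie_bracket A B | A B. A \<in> S \<and> B \<in> T}"

fun lower_central :: "nat \<Rightarrow> 'a::field mat set \<Rightarrow> nat \<Rightarrow> 'a mat set" where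
  "lower_central n L 0 = L"
| "lower_central n L (Suc k) = set_bracket n L (lower_central n L k)"

definition nilpotent_lie :: "nat \<Rightarrow> 'a::field mat set \<Rightarrow> bool" where
  "nilpotent_lie n L \<longleftrightarrow> (\<exists>k. lower_central n L k = {0\<^sub>m n n})"

definition lie_normalizer :: "'a::field mat set \<Rightarrow> 'a mat set \<Rightarrow> 'a mat set" where
  "lie_normalizer L M = {A \<in> L. \<forall>B\<in>M. lie_bracket A B \<in> M}"

definition cartan_subalgebra :: "nat \<Rightarrow> 'a::field mat set \<Rightarrow> 'a mat set \<Rightarrow> bool" where
  "cartan_subalgebra n L H \<longleftrightarrow>
     lie_subalgebra n L H \<and> nilpotent_lie n H \<and> lie_normalizer L H = H"

definition sl :: "nat \<Rightarrow> 'a::field mat set" where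
  "sl n = {A \<in> carrier_mat n n. (\<Sum>i<n. A $$ (i, i)) = 0}"

definition complexification :: "real mat set \<Rightarrow> complex mat set" where
  "complexification L =
     {map_mat complex_of_real X + \<i> \<cdot>\<^sub>m map_mat complex_of_real Y | X Y. X \<in> L \<and> Y \<in> L}"

text \<open>
  The conjugation with respect to the real form sends \<open>X + \<i> Y\<close> to \<open>X - \<i> Y\<close> for \<open>X, Y\<close> in the
  real form; on matrices this is entrywise complex conjugation, whatever the real form
  (lemma \<open>mat_conj_complexification\<close>).
\<close>
definition mat_conj :: "complex mat \<Rightarrow> complex mat" where
  "mat_conj = map_mat cnj"

definition mat_set_sum :: "'a::field mat set \<Rightarrow> 'a mat set \<Rightarrow> 'a mat set" where
  "mat_set_sum S T = {A + B | A B. A \<in> S \<and> B \<in> T}"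

definition complex_structure :: "nat \<Rightarrow> real mat set \<Rightarrow> complex mat set \<Rightarrow> bool" where
  "complex_structure n g0 q \<longleftrightarrow>
     lie_subalgebra n (complexification g0) q \<and>
     complexification g0 = mat_set_sum q (mat_conj ` q) \<and>
     q \<inter> mat_conj ` q = {0\<^sub>m n n}"

definition regular_wrt :: "complex mat set \<Rightarrow> complex mat set \<Rightarrow> bool" where
  "regular_wrt h q \<longleftrightarrow>
     (\<forall>A\<in>h. \<forall>B\<in>q. lie_bracket A B \<in> q) \<and>
     h = mat_set_sum (h \<inter> q) (mat_conj ` (h \<inter> q))"

definition non_regular :: "nat \<Rightarrow> real mat set \<Rightarrow> complex mat set \<Rightarrow> bool" where
  "non_regular n g0 q \<longleftrightarrow>
     \<not> (\<exists>h. cartan_subalgebra n (complexification g0) h \<and> regular_wrt h q)"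

lemma matrix_subspace_iff:
  fixes W :: "'a::field mat set"
  shows "matrix_subspace n W \<longleftrightarrow>
    W \<subseteq> carrier_mat n n \<and> 0\<^sub>m n n \<in> W \<and>
    (\<forall>A\<in>W. \<forall>B\<in>W. A + B \<in> W) \<and> (\<forall>c. \<forall>A\<in>W. c \<cdot>\<^sub>m A \<in> W)"
proof -
  interpret vectorspace "class_ring :: 'a ring" "module_mat TYPE('a) n n"
    by (rule matrix_vs)
  show ?thesis
    unfolding subspace_def submodule_def
    using vectorspace_axioms module_axioms
    by (auto simp: matrix_vs_simps)
qed

lemma matrix_span_eq:
  fixes S :: "'a::field mat set"
  assumes "S \<subseteq> carrier_mat n n"
  shows "matrix_span n S = \<Inter> {W. matrix_subspace n W \<and> S \<subseteq> W}"
proof -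
  interpret vectorspace "class_ring :: 'a ring" "module_mat TYPE('a) n n"
    by (rule matrix_vs)
  have S: "S \<subseteq> carrier (module_mat TYPE('a) n n)"
    using assms by (simp add: matrix_vs_simps)
  have "matrix_subspace n (matrix_span n S)" "S \<subseteq> matrix_span n S"
    using span_is_subspace[OF S] in_own_span[OF S] by auto
  moreover have "matrix_span n S \<subseteq> W" if "matrix_subspace n W" "S \<subseteq> W" for W
    using span_is_subset[OF that(2)] that(1) by (simp add: subspace_def)
  ultimately show ?thesis by blast
qed

lemma mat_conj_complexification:
  assumes "X \<in> carrier_mat n n" "Y \<in> carrier_mat n n"
  shows "mat_conj (map_mat complex_of_real X + \<i> \<cdot>\<^sub>m map_mat complex_of_real Y) =
           map_mat complex_of_real X - \<i> \<cdot>\<^sub>m map_mat complex_of_real Y"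
  using assms by (intro eq_matI) (auto simp: mat_conj_def)

lemma matrix_lie_algebra_sl: "matrix_lie_algebra n (sl n)"
proof -
  have "(\<Sum>i<n. (A * B - B * A) $$ (i, i)) = 0"
    if "A \<in> carrier_mat n n" "B \<in> carrier_mat n n" for A B :: "'a mat"
  proof -
    have "(\<Sum>i<n. (A * B) $$ (i, i)) = (\<Sum>i<n. \<Sum>j<n. A $$ (i, j) * B $$ (j, i))"
      using that by (auto simp: scalar_prod_def atLeast0LessThan intro!: sum.cong)
    also have "\<dots> = (\<Sum>j<n. \<Sum>i<n. A $$ (i, j) * B $$ (j, i))"
      by (rule sum.swap)
    also have "\<dots> = (\<Sum>i<n. (B * A) $$ (i, i))"
      using that by (auto simp: scalar_prod_def atLeast0LessThan mult.commute intro!: sum.cong)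
    finally show ?thesis using that by (simp add: sum_subtractf)
  qed
  then show ?thesis
    unfolding matrix_lie_algebra_def matrix_subspace_iff
    by (auto simp: sl_def lie_bracket_def sum.distrib simp flip: sum_distrib_left)
qed

lemma complexification_sl: "complexification (sl n) = sl n"
proof
  show "complexification (sl n) \<subseteq> sl n"
    by (auto simp: complexification_def sl_def sum.distrib
        simp flip: of_real_sum sum_distrib_left)
next
  show "sl n \<subseteq> complexification (sl n)"
  proof
    fix A :: "complex mat" assume A: "A \<in> sl n"
    have "A = map_mat complex_of_real (map_mat Re A) + \<i> \<cdot>\<^sub>m map_mat complex_of_real (map_mat Im A)"
      by (intro eq_matI) (auto simp: complex_eq_iff)
    moreover have "map_mat Re A \<in> sl n" "map_mat Im A \<in> sl n"
      using A by (auto simp: sl_def simp flip: Re_sum Im_sum)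
    ultimately show "A \<in> complexification (sl n)"
      unfolding complexification_def by blast
  qed
qed

end

theory Submission
  imports Defs
begin

text \<open>
  Put \<open>n = 2 * m - 1\<close>.  The complex structure is the subalgebra \<open>q\<close> of \<open>sl n\<close> over the complex
  numbers fixing \<open>m\<close> points \<open>[u j]\<close> of the projective space of dimension \<open>n - 1\<close>, that is, having
  every \<open>u j\<close> as an eigenvector.  Its dimension is \<open>(n\<^sup>2 - 1) - m * (n - 1) = 2 * m * (m - 1)\<close>, half
  of that of \<open>sl n\<close>, and its conjugate fixes the conjugate points.

  The \<open>u j\<close> are chosen so that they and their conjugates, \<open>2 * m = n + 1\<close> vectors in all, form
  a projective frame: their sum is zero and this is their only linear relation up to scaling.
  A matrix that fixes all points of a frame is scalar, hence zero if its trace is zero; this is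
  lemma \<open>eigen_frame_trivial\<close> and gives \<open>q \<inter> cnj q = 0\<close>.  Conversely a linear map may take
  prescribed values on the frame as soon as these values sum to zero, and adding suitable
  multiples of the frame vectors to arbitrary values makes the sum zero.  So each trace-free \<open>A\<close>
  agrees on the conjugate points, up to multiples of these, with a trace-free \<open>B\<close> in \<open>q\<close>; this is
  lemma \<open>exists_frame_decomposition\<close> and gives \<open>sl n = q + cnj q\<close>.

  The algebra \<open>q\<close> is its own normalizer, because for each \<open>j\<close> it contains a semisimple element
  for which \<open>u j\<close> spans an eigenspace (lemma \<open>line_stabilizer_self_normalizing\<close>).  This excludes
  regularity with respect to any Cartan subalgebra \<open>h\<close> (lemma \<open>non_regular_if_self_normalizing\<close>):
  as \<open>h\<close> normalizes \<open>q\<close>, it lies in \<open>q\<close>; then \<open>h = h + cnj h\<close> is stable under conjugation, so it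
  lies in \<open>q \<inter> cnj q = 0\<close>; but \<open>0\<close> is not a Cartan subalgebra of a nonzero Lie algebra.
\<close>

section \<open>Matrices and their conjugates\<close>

lemma smult_mat_mult_vec:
  fixes A :: "'a::comm_semiring_0 mat"
  assumes "A \<in> carrier_mat n k" "v \<in> carrier_vec k"
  shows "(c \<cdot>\<^sub>m A) *\<^sub>v v = c \<cdot>\<^sub>v (A *\<^sub>v v)"
  using assms by (intro eq_vecI) (auto simp: scalar_prod_def sum_distrib_left mult.assoc)

lemma sl_carrier: "A \<in> sl n \<Longrightarrow> A \<in> carrier_mat n n"
  by (simp add: sl_def)

lemma mat_conj_mat_conj [simp]: "mat_conj (mat_conj A) = A"
  by (intro eq_matI) (auto simp: mat_conj_def)

lemma mat_conj_zero [simp]: "mat_conj (0\<^sub>m n n) = 0\<^sub>m n n"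
  by (intro eq_matI) (auto simp: mat_conj_def)

lemma mat_conj_sl_iff [simp]: "mat_conj A \<in> sl n \<longleftrightarrow> A \<in> sl n"
proof -
  have "(\<Sum>i<n. mat_conj A $$ (i, i)) = cnj (\<Sum>i<n. A $$ (i, i))" if "A \<in> carrier_mat n n"
    using that by (simp add: mat_conj_def)
  moreover have "mat_conj A \<in> carrier_mat n n \<longleftrightarrow> A \<in> carrier_mat n n"
    by (simp add: mat_conj_def)
  ultimately show ?thesis by (auto simp: sl_def simp del: cnj_sum)
qed

section \<open>Self-normalizing complex structures are non-regular\<close>

lemma non_regular_if_self_normalizing:
  assumes q: "complex_structure n g0 q"
    and normalizer: "lie_normalizer (complexification g0) q \<subseteq> q"
    and nonzero: "complexification g0 \<noteq> {0\<^sub>m n n}"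
  shows "non_regular n g0 q"
  unfolding non_regular_def
proof
  let ?L = "complexification g0"
  have L: "?L = mat_set_sum q (mat_conj ` q)" and q0: "q \<inter> mat_conj ` q = {0\<^sub>m n n}"
    and qc: "q \<subseteq> carrier_mat n n"
    using q by (auto simp: complex_structure_def lie_subalgebra_def matrix_lie_algebra_def
        matrix_subspace_iff)
  have Lc: "?L \<subseteq> carrier_mat n n"
    unfolding L mat_set_sum_def using qc by (auto simp: mat_conj_def)
  assume "\<exists>h. cartan_subalgebra n ?L h \<and> regular_wrt h q"
  then obtain h where h: "cartan_subalgebra n ?L h" and r: "regular_wrt h q" by blast
  have hc: "h \<subseteq> carrier_mat n n" and h0: "0\<^sub>m n n \<in> h" and hL: "h \<subseteq> ?L"
    and hN: "lie_normalizer ?L h = h"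
    using h by (auto simp: cartan_subalgebra_def lie_subalgebra_def matrix_lie_algebra_def
        matrix_subspace_iff)
  have hq: "h \<subseteq> q"
    using normalizer hL r by (auto simp: regular_wrt_def lie_normalizer_def)
  then have hh: "h = mat_set_sum h (mat_conj ` h)"
    using r by (simp add: regular_wrt_def Int_absorb2)
  have "A = 0\<^sub>m n n" if "A \<in> h" for A
  proof -
    have "0\<^sub>m n n + mat_conj A \<in> mat_set_sum h (mat_conj ` h)"
      using that h0 unfolding mat_set_sum_def by blast
    moreover have "mat_conj A \<in> carrier_mat n n" using that hc by (auto simp: mat_conj_def)
    ultimately have "mat_conj A \<in> h" by (simp flip: hh)
    then have "mat_conj (mat_conj A) \<in> mat_conj ` q" using hq by blast
    then show ?thesis using that hq q0 by auto
  qed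
  then have h_zero: "h = {0\<^sub>m n n}" using h0 by blast
  \<comment> \<open>A Cartan subalgebra is its own normalizer, whereas everything normalizes \<open>0\<close>.\<close>
  have "lie_normalizer ?L {0\<^sub>m n n} = ?L"
    using Lc by (auto simp: lie_normalizer_def lie_bracket_def)
  then show False using hN nonzero by (simp add: h_zero)
qed

section \<open>Stabilizers of sets of lines\<close>

text \<open>
  The trace-free matrices that map each line spanned by a vector of \<open>S\<close> into itself.
\<close>
definition line_stabilizer :: "nat \<Rightarrow> 'a::field vec set \<Rightarrow> 'a mat set" where
  "line_stabilizer n S = {A \<in> sl n. \<forall>v\<in>S. \<exists>c. A *\<^sub>v v = c \<cdot>\<^sub>v v}"

lemma lie_subalgebra_line_stabilizer:
  fixes S :: "'a::field vec set"
  assumes S: "S \<subseteq> carrier_vec n"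
  shows "lie_subalgebra n (sl n) (line_stabilizer n S)"
proof -
  have L: "matrix_subspace n (sl n :: 'a mat set)"
    and bracket: "\<And>A B :: 'a mat. A \<in> sl n \<Longrightarrow> B \<in> sl n \<Longrightarrow> lie_bracket A B \<in> sl n"
    using matrix_lie_algebra_sl[of n, where 'a = 'a] by (simp_all add: matrix_lie_algebra_def)
  have sl: "(sl n :: 'a mat set) \<subseteq> carrier_mat n n" "0\<^sub>m n n \<in> (sl n :: 'a mat set)"
    "\<And>A B :: 'a mat. A \<in> sl n \<Longrightarrow> B \<in> sl n \<Longrightarrow> A + B \<in> sl n"
    "\<And>c (A :: 'a mat). A \<in> sl n \<Longrightarrow> c \<cdot>\<^sub>m A \<in> sl n"
    using L unfolding matrix_subspace_iff by simp_all
  let ?M = "line_stabilizer n S"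
  have M: "A \<in> sl n" "A \<in> carrier_mat n n" if "A \<in> ?M" for A
    using that sl(1) by (auto simp: line_stabilizer_def)
  have eigen: "\<exists>c. A *\<^sub>v v = c \<cdot>\<^sub>v v" if "A \<in> ?M" "v \<in> S" for A v
    using that by (simp add: line_stabilizer_def)
  have intro: "A \<in> ?M" if "A \<in> sl n" "\<And>v. v \<in> S \<Longrightarrow> \<exists>c. A *\<^sub>v v = c \<cdot>\<^sub>v v" for A
    using that by (simp add: line_stabilizer_def)
  have "?M \<subseteq> carrier_mat n n" using M(2) by (rule subsetI)
  moreover have "0\<^sub>m n n \<in> ?M"
  proof (rule intro[OF sl(2)])
    fix v assume "v \<in> S"
    then have "0\<^sub>m n n *\<^sub>v v = 0 \<cdot>\<^sub>v v"
      using S by (intro eq_vecI) (auto simp: scalar_prod_def)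
    then show "\<exists>c. 0\<^sub>m n n *\<^sub>v v = c \<cdot>\<^sub>v v" by (rule exI)
  qed
  moreover have "A + B \<in> ?M" if A: "A \<in> ?M" and B: "B \<in> ?M" for A B
  proof (rule intro[OF sl(3)[OF M(1)[OF A] M(1)[OF B]]])
    fix v assume v: "v \<in> S"
    obtain a b where ab: "A *\<^sub>v v = a \<cdot>\<^sub>v v" "B *\<^sub>v v = b \<cdot>\<^sub>v v"
      using eigen[OF A v] eigen[OF B v] by (elim exE)
    have "v \<in> carrier_vec n" using v S by (rule subsetD[rotated])
    then have "(A + B) *\<^sub>v v = (a + b) \<cdot>\<^sub>v v"
      using M(2)[OF A] M(2)[OF B]
      by (simp add: add_mult_distrib_mat_vec[of _ n n] ab add_smult_distrib_vec)
    then show "\<exists>c. (A + B) *\<^sub>v v = c \<cdot>\<^sub>v v" by (rule exI)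
  qed
  moreover have "x \<cdot>\<^sub>m A \<in> ?M" if A: "A \<in> ?M" for x A
  proof (rule intro[OF sl(4)[OF M(1)[OF A]]])
    fix v assume v: "v \<in> S"
    obtain a where a: "A *\<^sub>v v = a \<cdot>\<^sub>v v" using eigen[OF A v] by (elim exE)
    have "v \<in> carrier_vec n" using v S by (rule subsetD[rotated])
    then have "(x \<cdot>\<^sub>m A) *\<^sub>v v = (x * a) \<cdot>\<^sub>v v"
      using M(2)[OF A] by (simp add: smult_mat_mult_vec[of _ n n] a smult_smult_assoc)
    then show "\<exists>c. (x \<cdot>\<^sub>m A) *\<^sub>v v = c \<cdot>\<^sub>v v" by (rule exI)
  qed
  moreover have "lie_bracket A B \<in> ?M" if A: "A \<in> ?M" and B: "B \<in> ?M" for A B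
  proof (rule intro[OF bracket[OF M(1)[OF A] M(1)[OF B]]])
    fix v assume v: "v \<in> S"
    obtain a b where ab: "A *\<^sub>v v = a \<cdot>\<^sub>v v" "B *\<^sub>v v = b \<cdot>\<^sub>v v"
      using eigen[OF A v] eigen[OF B v] by (elim exE)
    have vc: "v \<in> carrier_vec n" using v S by (rule subsetD[rotated])
    have "lie_bracket A B *\<^sub>v v = A *\<^sub>v (B *\<^sub>v v) - B *\<^sub>v (A *\<^sub>v v)"
      unfolding lie_bracket_def using M(2)[OF A] M(2)[OF B] vc
      by (simp add: minus_mult_distrib_mat_vec[of _ n n] assoc_mult_mat_vec[of _ n n _ n])
    also have "\<dots> = (b * a) \<cdot>\<^sub>v v - (a * b) \<cdot>\<^sub>v v"
      using M(2)[OF A] M(2)[OF B] vc by (simp add: ab mult_mat_vec[of _ n n] smult_smult_assoc)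
    also have "\<dots> = 0 \<cdot>\<^sub>v v" using vc by (intro eq_vecI) (auto simp: mult.commute)
    finally show "\<exists>c. lie_bracket A B *\<^sub>v v = c \<cdot>\<^sub>v v" by (rule exI)
  qed
  ultimately show ?thesis
    unfolding lie_subalgebra_def matrix_lie_algebra_def matrix_subspace_iff
    using M(1) by (simp add: subsetI)
qed

lemma mat_conj_mult_vec:
  assumes "A \<in> carrier_mat n n" "v \<in> carrier_vec n"
  shows "mat_conj A *\<^sub>v map_vec cnj v = map_vec cnj (A *\<^sub>v v)"
  using assms by (intro eq_vecI) (auto simp: mat_conj_def scalar_prod_def)

lemma mat_conj_line_stabilizer_subset:
  assumes S: "S \<subseteq> carrier_vec n" and A: "A \<in> line_stabilizer n S"
  shows "mat_conj A \<in> line_stabilizer n (map_vec cnj ` S)"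
proof -
  have "\<exists>c. mat_conj A *\<^sub>v map_vec cnj v = c \<cdot>\<^sub>v map_vec cnj v" if v: "v \<in> S" for v
  proof -
    obtain c where "A *\<^sub>v v = c \<cdot>\<^sub>v v" using A v by (auto simp: line_stabilizer_def)
    then have "mat_conj A *\<^sub>v map_vec cnj v = map_vec cnj (c \<cdot>\<^sub>v v)"
      using A v S by (subst mat_conj_mult_vec) (auto simp: line_stabilizer_def sl_def)
    also have "\<dots> = cnj c \<cdot>\<^sub>v map_vec cnj v" by (intro eq_vecI) auto
    finally show ?thesis by blast
  qed
  then show ?thesis using A by (auto simp: line_stabilizer_def)
qed

lemma mat_conj_line_stabilizer:
  assumes S: "S \<subseteq> carrier_vec n"
  shows "mat_conj ` line_stabilizer n S = line_stabilizer n (map_vec cnj ` S)"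
proof
  show "mat_conj ` line_stabilizer n S \<subseteq> line_stabilizer n (map_vec cnj ` S)"
    using mat_conj_line_stabilizer_subset[OF S] by blast
next
  have "map_vec cnj (map_vec cnj v) = v" for v by (intro eq_vecI) auto
  then have "map_vec cnj ` map_vec cnj ` S = S" by (simp add: image_image)
  moreover have "map_vec cnj ` S \<subseteq> carrier_vec n" using S by auto
  ultimately have "mat_conj A \<in> line_stabilizer n S"
    if "A \<in> line_stabilizer n (map_vec cnj ` S)" for A
    using mat_conj_line_stabilizer_subset that by metis
  then show "line_stabilizer n (map_vec cnj ` S) \<subseteq> mat_conj ` line_stabilizer n S"
    by (metis (no_types, lifting) image_eqI mat_conj_mat_conj subsetI)
qed

text \<open>
  The hypothesis \<open>dual\<close> is a form of linear independence: some linear form is \<open>1\<close> at a given vector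
  of \<open>S\<close> and vanishes at all others.
\<close>
lemma line_stabilizer_self_normalizing:
  fixes S :: "'a::field_char_0 vec set"
  assumes S: "S \<subseteq> carrier_vec n"
    and dual: "\<And>v. v \<in> S \<Longrightarrow> \<exists>p \<in> carrier_vec n. p \<bullet> v = 1 \<and> (\<forall>w \<in> S - {v}. p \<bullet> w = 0)"
  shows "lie_normalizer (sl n) (line_stabilizer n S) \<subseteq> line_stabilizer n S"
proof
  fix A assume A: "A \<in> lie_normalizer (sl n) (line_stabilizer n S)"
  then have Asl: "A \<in> sl n" and Ac: "A \<in> carrier_mat n n"
    by (auto simp: lie_normalizer_def sl_def)
  have "\<exists>c. A *\<^sub>v v = c \<cdot>\<^sub>v v" if v: "v \<in> S" for v
  proof -
    obtain p where p: "p \<in> carrier_vec n" "p \<bullet> v = 1" "\<And>w. w \<in> S \<Longrightarrow> w \<noteq> v \<Longrightarrow> p \<bullet> w = 0"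
      using dual[OF v] by blast
    have vc: "v \<in> carrier_vec n" using v S by blast
    have "n \<noteq> 0" using p(2) vc by (intro notI) (auto simp: scalar_prod_def)
    then have n: "of_nat n \<noteq> (0 :: 'a)" by simp
    \<comment> \<open>The test element \<open>n v p\<^sup>T - 1\<close> is trace-free, has the vectors of \<open>S\<close> as eigenvectors, and
      its eigenspace for the eigenvalue \<open>n - 1\<close> is the line of \<open>v\<close>.  Evaluating \<open>[A, B]\<close>
      at \<open>v\<close> therefore shows that \<open>A v\<close> is a multiple of \<open>v\<close>.\<close>
    define B where "B = mat n n (\<lambda>(i, j). of_nat n * v $ i * p $ j - (if i = j then 1 else 0))"
    have Bc: "B \<in> carrier_mat n n" by (simp add: B_def)
    have B: "B *\<^sub>v w = (of_nat n * (p \<bullet> w)) \<cdot>\<^sub>v v - w" if w: "w \<in> carrier_vec n" for w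
    proof (intro eq_vecI)
      fix i assume "i < dim_vec ((of_nat n * (p \<bullet> w)) \<cdot>\<^sub>v v - w)"
      then have i: "i < n" using w by simp
      have "(B *\<^sub>v w) $ i = (\<Sum>j<n. (of_nat n * v $ i * p $ j - (if i = j then 1 else 0)) * w $ j)"
        using i w by (simp add: B_def scalar_prod_def atLeast0LessThan)
      also have "\<dots> = of_nat n * v $ i * (\<Sum>j<n. p $ j * w $ j) - (\<Sum>j<n. if i = j then w $ j else 0)"
        unfolding sum_distrib_left sum_subtractf[symmetric]
        by (intro sum.cong) (auto simp: algebra_simps)
      also have "\<dots> = ((of_nat n * (p \<bullet> w)) \<cdot>\<^sub>v v - w) $ i"
        using i w vc by (simp add: scalar_prod_def atLeast0LessThan)
      finally show "(B *\<^sub>v w) $ i = ((of_nat n * (p \<bullet> w)) \<cdot>\<^sub>v v - w) $ i" .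
    qed (use w Bc in auto)
    have "(\<Sum>i<n. B $$ (i, i)) = of_nat n * (p \<bullet> v) - of_nat n"
      using vc by (simp add: B_def scalar_prod_def atLeast0LessThan sum_subtractf sum_distrib_left
          mult_ac)
    then have "B \<in> sl n" using Bc p(2) by (simp add: sl_def)
    moreover have "\<exists>c. B *\<^sub>v w = c \<cdot>\<^sub>v w" if w: "w \<in> S" for w
    proof (cases "w = v")
      case True
      have "B *\<^sub>v v = (of_nat n - 1) \<cdot>\<^sub>v v"
        using B[OF vc] p(2) vc by (intro eq_vecI) (auto simp: algebra_simps)
      then show ?thesis using True by blast
    next
      case False
      have wc: "w \<in> carrier_vec n" using w S by blast
      have "B *\<^sub>v w = (- 1) \<cdot>\<^sub>v w"
        using B[OF wc] p(3)[OF w False] vc wc by (intro eq_vecI) auto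
      then show ?thesis by blast
    qed
    ultimately have "B \<in> line_stabilizer n S" by (simp add: line_stabilizer_def)
    then have "lie_bracket A B \<in> line_stabilizer n S" using A by (simp add: lie_normalizer_def)
    then obtain c where c: "lie_bracket A B *\<^sub>v v = c \<cdot>\<^sub>v v"
      using v by (auto simp: line_stabilizer_def)
    define y where "y = A *\<^sub>v v"
    have yc: "y \<in> carrier_vec n" using Ac vc by (simp add: y_def)
    have "lie_bracket A B *\<^sub>v v = A *\<^sub>v (B *\<^sub>v v) - B *\<^sub>v y"
      unfolding lie_bracket_def y_def using Ac Bc vc
      by (subst minus_mult_distrib_mat_vec) (auto simp: assoc_mult_mat_vec[of _ n n _ n])
    also have "A *\<^sub>v (B *\<^sub>v v) = of_nat n \<cdot>\<^sub>v y - y"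
      unfolding B[OF vc] p(2) y_def using Ac vc
      by (subst mult_minus_distrib_mat_vec) (auto simp: mult_mat_vec)
    also have "B *\<^sub>v y = (of_nat n * (p \<bullet> y)) \<cdot>\<^sub>v v - y" by (rule B[OF yc])
    finally have eq: "c \<cdot>\<^sub>v v = (of_nat n \<cdot>\<^sub>v y - y) - ((of_nat n * (p \<bullet> y)) \<cdot>\<^sub>v v - y)"
      using c by simp
    have "y = (c / of_nat n + p \<bullet> y) \<cdot>\<^sub>v v"
    proof (intro eq_vecI)
      fix i assume "i < dim_vec ((c / of_nat n + p \<bullet> y) \<cdot>\<^sub>v v)"
      then have i: "i < n" using vc by simp
      from arg_cong[OF eq, of "\<lambda>x. x $ i"]
      have "c * v $ i = of_nat n * y $ i - of_nat n * (p \<bullet> y) * v $ i"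
        using i vc yc by simp
      then show "y $ i = ((c / of_nat n + p \<bullet> y) \<cdot>\<^sub>v v) $ i"
        using i vc n by (simp add: field_simps)
    qed (use yc vc in auto)
    then show ?thesis unfolding y_def by blast
  qed
  then show "A \<in> line_stabilizer n S" using Asl by (simp add: line_stabilizer_def)
qed

section \<open>A projective frame stable under conjugation\<close>

text \<open>
  The vectors \<open>a j\<close> for \<open>j < m\<close>, with real entries: \<open>a j\<close> is the unit vector \<open>m + j\<close> for
  \<open>j < m - 1\<close>, and \<open>a (m - 1)\<close> is minus the sum of these.  Hence the \<open>a j\<close> span the coordinates
  from \<open>m\<close> on, and their only linear relation up to scaling is that they sum to zero.
\<close>
definition frame_re :: "nat \<Rightarrow> nat \<Rightarrow> complex vec" where
  "frame_re m j = vec (2 * m - 1)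
     (\<lambda>r. if r < m then 0 else if Suc j = m then - 1 else if r = m + j then 1 else 0)"

text \<open>
  The vectors \<open>u j = a j + \<i> e j\<close>, where \<open>e j\<close> is the unit vector \<open>j\<close>.  For \<open>j < m\<close> they form,
  together with their conjugates \<open>a j - \<i> e j\<close>, a projective frame whose sum is zero.
\<close>
definition frame_vec :: "nat \<Rightarrow> nat \<Rightarrow> complex vec" where
  "frame_vec m j = frame_re m j + \<i> \<cdot>\<^sub>v unit_vec (2 * m - 1) j"

lemma frame_re_carrier: "frame_re m j \<in> carrier_vec (2 * m - 1)"
  by (simp add: frame_re_def)

lemma frame_vec_carrier: "frame_vec m j \<in> carrier_vec (2 * m - 1)"
  by (simp add: frame_vec_def frame_re_carrier[simplified])

lemmas frame_carrier [simp] = frame_re_carrier[simplified] frame_vec_carrier[simplified]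

lemma dim_frame [simp]: "dim_vec (frame_re m j) = 2 * m - 1" "dim_vec (frame_vec m j) = 2 * m - 1"
  by (simp_all add: frame_re_def frame_vec_def)

lemma frame_vec_index:
  assumes "r < 2 * m - 1"
  shows "frame_vec m j $ r = frame_re m j $ r + \<i> * (if r = j then 1 else 0)"
  using assms by (simp add: frame_vec_def unit_vec_def)

lemma cnj_frame_vec_index:
  assumes "r < 2 * m - 1"
  shows "map_vec cnj (frame_vec m j) $ r = frame_re m j $ r - \<i> * (if r = j then 1 else 0)"
  using assms by (simp add: frame_vec_def frame_re_def unit_vec_def)

lemma frame_re_low: "r < m \<Longrightarrow> frame_re m j $ r = 0"
  by (simp add: frame_re_def)

lemma sum_mult_frame_re:
  assumes "l < m - 1"
  shows "(\<Sum>j<m. f j * frame_re m j $ (m + l)) = f l - f (m - 1)"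
proof -
  obtain k where m: "m = Suc k" and l: "l < k" using assms by (cases m) auto
  have "(\<Sum>j<k. f j * frame_re m j $ (m + l)) = (\<Sum>j<k. if l = j then f j else 0)"
    using l m by (intro sum.cong) (auto simp: frame_re_def)
  then show ?thesis using l m by (simp add: frame_re_def)
qed

lemma sum_frame_re:
  assumes "r < 2 * m - 1"
  shows "(\<Sum>j<m. frame_re m j $ r) = 0"
proof (cases "r < m")
  case True
  then show ?thesis by (simp add: frame_re_low)
next
  case False
  then have "r - m < m - 1" "m + (r - m) = r" using assms by auto
  then show ?thesis using sum_mult_frame_re[of "r - m" m "\<lambda>_. 1"] by simp
qed

lemma mult_frame_re_index:
  assumes A: "A \<in> carrier_mat (2 * m - 1) (2 * m - 1)" and r: "r < 2 * m - 1"
  shows "(A *\<^sub>v frame_re m j) $ r = (\<Sum>i<2 * m - 1. A $$ (r, i) * frame_re m j $ i)"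
  using assms by (simp add: scalar_prod_def atLeast0LessThan)

lemma sum_mult_frame_re_vec:
  assumes A: "A \<in> carrier_mat (2 * m - 1) (2 * m - 1)" and r: "r < 2 * m - 1"
  shows "(\<Sum>j<m. (A *\<^sub>v frame_re m j) $ r) = 0"
proof -
  have "(\<Sum>j<m. (A *\<^sub>v frame_re m j) $ r)
      = (\<Sum>i<2 * m - 1. \<Sum>j<m. A $$ (r, i) * frame_re m j $ i)"
    unfolding mult_frame_re_index[OF assms] by (rule sum.swap)
  also have "\<dots> = 0"
  proof (rule sum.neutral, rule ballI)
    fix i assume "i \<in> {..<2 * m - 1}"
    then have "(\<Sum>j<m. frame_re m j $ i) = 0" by (intro sum_frame_re) simp
    then show "(\<Sum>j<m. A $$ (r, i) * frame_re m j $ i) = 0"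
      by (simp flip: sum_distrib_left)
  qed
  finally show ?thesis .
qed

lemma mult_frame_re_low:
  assumes A: "A \<in> carrier_mat (2 * m - 1) (2 * m - 1)" and r: "r < 2 * m - 1" and j: "j < m - 1"
  shows "(A *\<^sub>v frame_re m j) $ r = A $$ (r, m + j)"
proof -
  have "(A *\<^sub>v frame_re m j) $ r = (\<Sum>i<2 * m - 1. if m + j = i then A $$ (r, i) else 0)"
    unfolding mult_frame_re_index[OF A r] using j
    by (intro sum.cong) (auto simp: frame_re_def)
  then show ?thesis using j by simp
qed

text \<open>
  The values \<open>w j\<close> that a matrix is to take on the \<open>a j\<close> can be prescribed by choosing the columns
  from \<open>m\<close> on, provided that the \<open>w j\<close> sum to zero.
\<close>
lemma mult_frame_re_eq:
  assumes A: "A \<in> carrier_mat (2 * m - 1) (2 * m - 1)" and r: "r < 2 * m - 1"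
    and cols: "\<And>l. l < m - 1 \<Longrightarrow> A $$ (r, m + l) = w l" and w: "(\<Sum>j<m. w j) = 0" and j: "j < m"
  shows "(A *\<^sub>v frame_re m j) $ r = w j"
proof (cases "j < m - 1")
  case True
  then show ?thesis using mult_frame_re_low[OF A r] cols by simp
next
  case False
  then obtain k where m: "m = Suc k" and k: "j = k" using j by (cases m) auto
  have "(\<Sum>l<k. (A *\<^sub>v frame_re m l) $ r) = (\<Sum>l<k. w l)"
    using mult_frame_re_low[OF A r] cols m by (intro sum.cong) auto
  then show ?thesis
    using sum_mult_frame_re_vec[OF A r] w m k by (simp add: add_eq_0_iff)
qed

lemma mult_frame_vec_index:
  assumes A: "A \<in> carrier_mat (2 * m - 1) (2 * m - 1)" and r: "r < 2 * m - 1" and j: "j < m"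
  shows "(A *\<^sub>v frame_vec m j) $ r = (A *\<^sub>v frame_re m j) $ r + \<i> * A $$ (r, j)"
    and "(A *\<^sub>v map_vec cnj (frame_vec m j)) $ r = (A *\<^sub>v frame_re m j) $ r - \<i> * A $$ (r, j)"
proof -
  let ?n = "2 * m - 1"
  have jn: "j < ?n" using j by auto
  have u: "(A *\<^sub>v unit_vec ?n j) $ r = A $$ (r, j)"
    using A r jn by (simp add: scalar_prod_right_unit)
  have e: "map_vec cnj (frame_vec m j) = frame_re m j - \<i> \<cdot>\<^sub>v unit_vec ?n j"
    by (intro eq_vecI) (auto simp: frame_vec_index unit_vec_def frame_re_def)
  show "(A *\<^sub>v frame_vec m j) $ r = (A *\<^sub>v frame_re m j) $ r + \<i> * A $$ (r, j)"
    unfolding frame_vec_def using A r u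
    by (subst mult_add_distrib_mat_vec[of _ ?n ?n])
      (auto simp: mult_mat_vec[of _ ?n ?n] simp del: index_mult_mat_vec)
  show "(A *\<^sub>v map_vec cnj (frame_vec m j)) $ r = (A *\<^sub>v frame_re m j) $ r - \<i> * A $$ (r, j)"
    unfolding e using A r u
    by (subst mult_minus_distrib_mat_vec[of _ ?n ?n])
      (auto simp: mult_mat_vec[of _ ?n ?n] simp del: index_mult_mat_vec)
qed

text \<open>
  A matrix fixing all points of the frame is scalar, so it is zero if its trace is.  Write the
  eigenvalues \<open>t j\<close> and \<open>s j\<close> on \<open>u j\<close> and its conjugate as \<open>c j + d j\<close> and \<open>c j - d j\<close>.  Applying the
  matrix to the relation between the \<open>a j\<close> yields \<open>d j = 0\<close> from the coordinates below \<open>m\<close>, and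
  \<open>c j = c (m - 1)\<close> from the others.
\<close>
lemma eigen_frame_trivial:
  fixes A :: "complex mat"
  assumes m: "m \<ge> 1" and A: "A \<in> sl (2 * m - 1)"
    and t: "\<And>j. j < m \<Longrightarrow> A *\<^sub>v frame_vec m j = t j \<cdot>\<^sub>v frame_vec m j"
    and s: "\<And>j. j < m \<Longrightarrow>
      A *\<^sub>v map_vec cnj (frame_vec m j) = s j \<cdot>\<^sub>v map_vec cnj (frame_vec m j)"
  shows "A = 0\<^sub>m (2 * m - 1) (2 * m - 1)"
proof -
  let ?n = "2 * m - 1"
  have Ac: "A \<in> carrier_mat ?n ?n" using A by (rule sl_carrier)
  define d c where "d j = (t j - s j) / 2" and "c j = (t j + s j) / 2" for j
  have X: "(A *\<^sub>v frame_re m j) $ r = c j * frame_re m j $ r + \<i> * d j * (if r = j then 1 else 0)"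
    and Y: "A $$ (r, j) = c j * (if r = j then 1 else 0) - \<i> * d j * frame_re m j $ r"
    if r: "r < ?n" and j: "j < m" for r j
  proof -
    let ?a = "frame_re m j $ r" and ?b = "(if r = j then 1 else 0) :: complex"
    have 1: "(A *\<^sub>v frame_re m j) $ r + \<i> * A $$ (r, j) = t j * (?a + \<i> * ?b)"
      using mult_frame_vec_index(1)[OF Ac r j] t[OF j] r by (simp add: frame_vec_index)
    have 2: "(A *\<^sub>v frame_re m j) $ r - \<i> * A $$ (r, j) = s j * (?a - \<i> * ?b)"
    proof -
      have "(A *\<^sub>v map_vec cnj (frame_vec m j)) $ r = s j * map_vec cnj (frame_vec m j) $ r"
        unfolding s[OF j] using r by simp
      then show ?thesis
        unfolding mult_frame_vec_index(2)[OF Ac r j] cnj_frame_vec_index[OF r] .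
    qed
    have ts: "t j = c j + d j" "s j = c j - d j" by (simp_all add: d_def c_def field_simps)
    have "2 * (A *\<^sub>v frame_re m j) $ r = t j * (?a + \<i> * ?b) + s j * (?a - \<i> * ?b)"
      unfolding 1[symmetric] 2[symmetric] by simp
    also have "\<dots> = 2 * (c j * ?a + \<i> * d j * ?b)" unfolding ts by (simp add: algebra_simps)
    finally show "(A *\<^sub>v frame_re m j) $ r = c j * ?a + \<i> * d j * ?b"
      by (simp only: mult_left_cancel[OF zero_neq_numeral[symmetric]])
    have "2 * A $$ (r, j) = - \<i> * (t j * (?a + \<i> * ?b) - s j * (?a - \<i> * ?b))"
      unfolding 1[symmetric] 2[symmetric] by (simp add: algebra_simps)
    also have "\<dots> = 2 * (c j * ?b - \<i> * d j * ?a)" unfolding ts by (simp add: algebra_simps)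
    finally show "A $$ (r, j) = c j * ?b - \<i> * d j * ?a"
      by (simp only: mult_left_cancel[OF zero_neq_numeral[symmetric]])
  qed
  have d0: "d k = 0" if k: "k < m" for k
  proof -
    have kn: "k < ?n" using k by auto
    have "0 = (\<Sum>j<m. (A *\<^sub>v frame_re m j) $ k)" using sum_mult_frame_re_vec[OF Ac kn] by simp
    also have "\<dots> = (\<Sum>j<m. if k = j then \<i> * d j else 0)"
      using k by (intro sum.cong) (auto simp: X[OF kn] frame_re_low simp del: index_mult_mat_vec)
    finally show ?thesis using k by simp
  qed
  define lam where "lam = c (m - 1)"
  have c_eq: "c k = lam" if k: "k < m" for k
  proof (cases "k < m - 1")
    case True
    then have kn: "m + k < ?n" by auto
    have "0 = (\<Sum>j<m. (A *\<^sub>v frame_re m j) $ (m + k))" using sum_mult_frame_re_vec[OF Ac kn] by simp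
    also have "\<dots> = (\<Sum>j<m. c j * frame_re m j $ (m + k))"
      by (intro sum.cong) (auto simp: X[OF kn] d0 simp del: index_mult_mat_vec)
    finally show ?thesis using True by (simp add: sum_mult_frame_re lam_def)
  next
    case False
    then have "k = m - 1" using k by simp
    then show ?thesis by (simp add: lam_def)
  qed
  have entry: "A $$ (r, k) = (if r = k then lam else 0)" if r: "r < ?n" and k: "k < ?n" for r k
  proof (cases "k < m")
    case True
    then show ?thesis using Y[OF r True] d0 c_eq by simp
  next
    case False
    define l where "l = k - m"
    have l: "l < m - 1" "k = m + l" using False k by (auto simp: l_def)
    have "A $$ (r, k) = (A *\<^sub>v frame_re m l) $ r" using mult_frame_re_low[OF Ac r l(1)] l by simp
    also have "\<dots> = lam * frame_re m l $ r" using X[OF r, of l] l c_eq d0 by simp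
    finally show ?thesis using l r by (auto simp: frame_re_def)
  qed
  have "of_nat ?n * lam = 0" using A entry by (simp add: sl_def)
  then have "lam = 0" using m by (simp only: mult_eq_0_iff of_nat_eq_0_iff) auto
  then show ?thesis using entry Ac by (intro eq_matI) auto
qed

text \<open>
  The matrix \<open>B\<close> is found with eigenvalue \<open>t j\<close> on \<open>u j\<close> and value \<open>A (cnj (u j)) - s j * cnj (u j)\<close> on
  the conjugate of \<open>u j\<close>.  With \<open>z\<close> the sum of the \<open>A (cnj (u j))\<close>, such a \<open>B\<close> exists if the sum of
  the \<open>t j * u j - s j * cnj (u j)\<close> is \<open>- z\<close>.  The coordinates of \<open>z\<close> below \<open>m\<close> determine
  the \<open>t j + s j\<close>, and the others determine \<open>d j = t j - s j\<close> up to a common additive constant, which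
  amounts to adding a scalar matrix to \<open>B\<close> and is used at the end to make \<open>B\<close> trace-free.
\<close>
lemma exists_frame_decomposition:
  fixes A :: "complex mat"
  assumes m: "m \<ge> 1" and A: "A \<in> sl (2 * m - 1)"
  shows "\<exists>B \<in> sl (2 * m - 1). (\<forall>j<m. \<exists>c. B *\<^sub>v frame_vec m j = c \<cdot>\<^sub>v frame_vec m j) \<and>
    (\<forall>j<m. \<exists>c. (A - B) *\<^sub>v map_vec cnj (frame_vec m j) = c \<cdot>\<^sub>v map_vec cnj (frame_vec m j))"
proof -
  let ?n = "2 * m - 1"
  have Ac: "A \<in> carrier_mat ?n ?n" using A by (rule sl_carrier)
  define y where "y j r = (A *\<^sub>v map_vec cnj (frame_vec m j)) $ r" for j r
  define z where "z r = (\<Sum>j<m. y j r)" for r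
  define d where "d k = (if k < m - 1 then - z (m + k) else 0)" for k
  define t s where "t k = (\<i> * z k + d k) / 2" and "s k = (\<i> * z k - d k) / 2" for k
  define u v where "u j r = frame_vec m j $ r" and "v j r = map_vec cnj (frame_vec m j) $ r" for j r
  \<comment> \<open>The entries of the images of \<open>a j\<close> and \<open>e j\<close> that yield the required images of \<open>u j\<close>
    and its conjugate.\<close>
  define w where "w r j = (t j * u j r + y j r - s j * v j r) / 2" for r j
  define x where "x r j = (t j * u j r - y j r + s j * v j r) / (2 * \<i>)" for r j
  have uv: "u j r = frame_re m j $ r + \<i> * (if r = j then 1 else 0)"
    "v j r = frame_re m j $ r - \<i> * (if r = j then 1 else 0)" if "r < ?n" for j r
    using that by (simp_all only: u_def v_def frame_vec_index cnj_frame_vec_index)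
  have w_sum: "(\<Sum>j<m. w r j) = 0" if r: "r < ?n" for r
  proof -
    have "2 * w r j = y j r + d j * frame_re m j $ r - (if r = j then z j else 0)" for j
      using r by (simp add: w_def uv t_def s_def field_simps)
    then have "2 * (\<Sum>j<m. w r j)
        = z r + (\<Sum>j<m. d j * frame_re m j $ r) - (\<Sum>j<m. if r = j then z j else 0)"
      by (simp add: sum_distrib_left sum.distrib sum_subtractf z_def)
    also have "\<dots> = 0"
    proof (cases "r < m")
      case True
      then show ?thesis by (simp add: frame_re_low)
    next
      case False
      then have "r - m < m - 1" "m + (r - m) = r" using r by auto
      then show ?thesis using sum_mult_frame_re[of "r - m" m d] False by (simp add: d_def)
    qed
    finally show ?thesis by simp
  qed
  define B0 where "B0 = mat ?n ?n (\<lambda>(r, c). if c < m then x r c else w r (c - m))"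
  have B0c: "B0 \<in> carrier_mat ?n ?n" by (simp add: B0_def)
  have B0x: "B0 $$ (r, j) = x r j" if "r < ?n" "j < m" for r j
    using that by (simp add: B0_def)
  have B0w: "(B0 *\<^sub>v frame_re m j) $ r = w r j" if r: "r < ?n" and j: "j < m" for r j
    using mult_frame_re_eq[OF B0c r _ w_sum[OF r] j] r by (simp add: B0_def)
  define \<tau> where "\<tau> = (\<Sum>i<?n. B0 $$ (i, i)) / of_nat ?n"
  define B where "B = B0 - \<tau> \<cdot>\<^sub>m 1\<^sub>m ?n"
  have Bc: "B \<in> carrier_mat ?n ?n" 
    unfolding B_def by (intro minus_carrier_mat smult_carrier_mat one_carrier_mat)
  have shift: "(B *\<^sub>v a) $ r = (B0 *\<^sub>v a) $ r - \<tau> * a $ r" if "a \<in> carrier_vec ?n" "r < ?n" for a r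
    unfolding B_def using that B0c
    by (simp add: minus_mult_distrib_mat_vec[of _ ?n ?n] smult_mat_mult_vec[of _ ?n ?n]
        del: index_mult_mat_vec)
  have n0: "of_nat ?n \<noteq> (0 :: complex)" using m by (simp only: of_nat_eq_0_iff)
  have "(\<Sum>i<?n. B $$ (i, i)) = (\<Sum>i<?n. B0 $$ (i, i)) - \<tau> * of_nat ?n"
    using B0c by (simp add: B_def sum_subtractf)
  also have "\<dots> = 0"
    by (simp only: \<tau>_def[unfolded nonzero_eq_divide_eq[OF n0]] diff_self)
  finally have "B \<in> sl ?n" using Bc by (simp add: sl_def)
  moreover have "B *\<^sub>v frame_vec m j = (t j - \<tau>) \<cdot>\<^sub>v frame_vec m j" if j: "j < m" for j
  proof (intro eq_vecI)
    fix r assume "r < dim_vec ((t j - \<tau>) \<cdot>\<^sub>v frame_vec m j)"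
    then have r: "r < ?n" by simp
    have "(B *\<^sub>v frame_vec m j) $ r = w r j + \<i> * x r j - \<tau> * u j r"
      using shift[OF frame_vec_carrier r] mult_frame_vec_index(1)[OF B0c r j]
      by (simp only: B0w[OF r j] B0x[OF r j] u_def)
    also have "\<dots> = (t j - \<tau>) * u j r" by (simp add: w_def x_def field_simps)
    finally show "(B *\<^sub>v frame_vec m j) $ r = ((t j - \<tau>) \<cdot>\<^sub>v frame_vec m j) $ r"
      using r by (simp add: u_def)
  qed (use Bc in auto)
  moreover have "(A - B) *\<^sub>v map_vec cnj (frame_vec m j)
      = (s j + \<tau>) \<cdot>\<^sub>v map_vec cnj (frame_vec m j)" if j: "j < m" for j
  proof (intro eq_vecI)
    fix r assume "r < dim_vec ((s j + \<tau>) \<cdot>\<^sub>v map_vec cnj (frame_vec m j))"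
    then have r: "r < ?n" by simp
    have c: "map_vec cnj (frame_vec m j) \<in> carrier_vec ?n" by simp
    have "((A - B) *\<^sub>v map_vec cnj (frame_vec m j)) $ r
        = y j r - (B *\<^sub>v map_vec cnj (frame_vec m j)) $ r"
      unfolding y_def using Ac Bc r c
      by (subst minus_mult_distrib_mat_vec[of _ ?n ?n]) (auto simp del: index_mult_mat_vec)
    also have "\<dots> = y j r - (w r j - \<i> * x r j - \<tau> * v j r)"
      using shift[OF c r] mult_frame_vec_index(2)[OF B0c r j]
      by (simp only: B0w[OF r j] B0x[OF r j] v_def)
    also have "\<dots> = (s j + \<tau>) * v j r" by (simp add: w_def x_def field_simps)
    finally show "((A - B) *\<^sub>v map_vec cnj (frame_vec m j)) $ r
        = ((s j + \<tau>) \<cdot>\<^sub>v map_vec cnj (frame_vec m j)) $ r"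
      using r by (simp add: v_def)
  qed (use Ac Bc in auto)
  ultimately show ?thesis by blast
qed

section \<open>The complex structure\<close>

text \<open>The trace-free matrices fixing the \<open>m\<close> points of the frame that are not conjugated.\<close>
definition frame_stabilizer :: "nat \<Rightarrow> complex mat set" where
  "frame_stabilizer m = line_stabilizer (2 * m - 1) (frame_vec m ` {..<m})"

lemma complex_structure_frame_stabilizer:
  assumes m: "m \<ge> 1"
  shows "complex_structure (2 * m - 1) (sl (2 * m - 1)) (frame_stabilizer m)"
proof -
  let ?n = "2 * m - 1" and ?q = "frame_stabilizer m"
  have S: "frame_vec m ` {..<m} \<subseteq> carrier_vec ?n" by auto
  have sub: "lie_subalgebra ?n (sl ?n) ?q"
    unfolding frame_stabilizer_def by (rule lie_subalgebra_line_stabilizer[OF S])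
  have conj: "mat_conj ` ?q = line_stabilizer ?n ((\<lambda>j. map_vec cnj (frame_vec m j)) ` {..<m})"
    unfolding frame_stabilizer_def mat_conj_line_stabilizer[OF S] image_image ..
  have zero: "A = 0\<^sub>m ?n ?n" if A: "A \<in> ?q" "A \<in> mat_conj ` ?q" for A
  proof -
    have "\<forall>j. \<exists>c. j < m \<longrightarrow> A *\<^sub>v frame_vec m j = c \<cdot>\<^sub>v frame_vec m j"
      using A(1) by (auto simp: frame_stabilizer_def line_stabilizer_def)
    then obtain t where t: "\<And>j. j < m \<Longrightarrow> A *\<^sub>v frame_vec m j = t j \<cdot>\<^sub>v frame_vec m j"
      by metis
    have "\<forall>j. \<exists>c. j < m \<longrightarrow>
        A *\<^sub>v map_vec cnj (frame_vec m j) = c \<cdot>\<^sub>v map_vec cnj (frame_vec m j)"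
      using A(2) unfolding conj by (auto simp: line_stabilizer_def)
    then obtain s where s: "\<And>j. j < m \<Longrightarrow>
        A *\<^sub>v map_vec cnj (frame_vec m j) = s j \<cdot>\<^sub>v map_vec cnj (frame_vec m j)"
      by metis
    have "A \<in> sl ?n" using A(1) by (simp add: frame_stabilizer_def line_stabilizer_def)
    then show ?thesis using eigen_frame_trivial[OF m _ t s] by blast
  qed
  have "0\<^sub>m ?n ?n \<in> ?q"
    using sub by (auto simp: lie_subalgebra_def matrix_lie_algebra_def matrix_subspace_iff)
  then have "0\<^sub>m ?n ?n \<in> ?q \<inter> mat_conj ` ?q"
    using mat_conj_zero[of ?n] by (metis IntI image_eqI)
  then have int: "?q \<inter> mat_conj ` ?q = {0\<^sub>m ?n ?n}" using zero by blast
  have "A \<in> mat_set_sum ?q (mat_conj ` ?q)" if A: "A \<in> sl ?n" for A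
  proof -
    obtain B where B: "B \<in> sl ?n"
      and t: "\<forall>j<m. \<exists>c. B *\<^sub>v frame_vec m j = c \<cdot>\<^sub>v frame_vec m j"
      and s: "\<forall>j<m. \<exists>c.
        (A - B) *\<^sub>v map_vec cnj (frame_vec m j) = c \<cdot>\<^sub>v map_vec cnj (frame_vec m j)"
      using exists_frame_decomposition[OF m A] by blast
    have "B \<in> ?q" using B t by (auto simp: frame_stabilizer_def line_stabilizer_def)
    moreover have "A - B \<in> sl ?n" using A B by (auto simp: sl_def sum_subtractf)
    then have "A - B \<in> mat_conj ` ?q" unfolding conj using s by (auto simp: line_stabilizer_def)
    moreover have "A = B + (A - B)"
      using A B by (intro eq_matI) (auto simp: sl_def)
    ultimately show ?thesis unfolding mat_set_sum_def by blast
  qed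
  moreover have "A \<in> sl ?n" if "A \<in> mat_set_sum ?q (mat_conj ` ?q)" for A
  proof -
    from that obtain B C where A: "A = B + mat_conj C" and BC: "B \<in> ?q" "C \<in> ?q"
      unfolding mat_set_sum_def by blast
    then have "B \<in> sl ?n" "mat_conj C \<in> sl ?n"
      by (simp_all add: frame_stabilizer_def line_stabilizer_def)
    then show ?thesis unfolding A by (auto simp: sl_def sum.distrib)
  qed
  ultimately have "sl ?n = mat_set_sum ?q (mat_conj ` ?q)" by blast
  then show ?thesis using sub int by (simp add: complex_structure_def complexification_sl)
qed

lemma non_regular_frame_stabilizer:
  assumes m: "m \<ge> 2"
  shows "non_regular (2 * m - 1) (sl (2 * m - 1)) (frame_stabilizer m)"
proof (rule non_regular_if_self_normalizing)
  let ?n = "2 * m - 1"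
  show "complex_structure ?n (sl ?n) (frame_stabilizer m)"
    using m by (intro complex_structure_frame_stabilizer) simp
  have "\<exists>p \<in> carrier_vec ?n. p \<bullet> v = 1 \<and> (\<forall>w \<in> frame_vec m ` {..<m} - {v}. p \<bullet> w = 0)"
    if "v \<in> frame_vec m ` {..<m}" for v
  proof -
    from that obtain j where j: "j < m" "v = frame_vec m j" by (auto simp del: One_nat_def)
    \<comment> \<open>The coordinates below \<open>m\<close> of \<open>u k\<close> are those of \<open>\<i> e k\<close>.\<close>
    define p :: "complex vec" where "p = (- \<i>) \<cdot>\<^sub>v unit_vec ?n j"
    have p: "p \<bullet> frame_vec m k = (if k = j then 1 else 0)" if "k < m" for k
      using j m that unfolding p_def
      by (simp add: frame_vec_index frame_re_low scalar_prod_left_unit)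
    have "p \<bullet> w = 0" if "w \<in> frame_vec m ` {..<m} - {v}" for w
    proof -
      from that obtain k where k: "k < m" "w = frame_vec m k" and "w \<noteq> v" by auto
      then have "k \<noteq> j" using j by blast
      then show ?thesis using p k by simp
    qed
    then show ?thesis using j p[of j] by (intro bexI[of _ p]) (auto simp: p_def)
  qed
  then show "lie_normalizer (complexification (sl ?n)) (frame_stabilizer m) \<subseteq> frame_stabilizer m"
    unfolding complexification_sl frame_stabilizer_def
    by (intro line_stabilizer_self_normalizing) auto
  define E :: "complex mat" where
    "E = mat ?n ?n (\<lambda>(i, j). if i = 0 \<and> j = 1 then 1 else 0)"
  have "E \<in> sl ?n" by (auto simp: E_def sl_def intro!: sum.neutral)
  moreover have "E $$ (0, 1) \<noteq> 0\<^sub>m ?n ?n $$ (0, 1)" using m by (simp add: E_def)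
  ultimately show "complexification (sl ?n) \<noteq> {0\<^sub>m ?n ?n}" unfolding complexification_sl by auto
qed

theorem theorem5p2:
  fixes m :: nat
  assumes "m \<ge> 2"
  shows "\<exists>q. complex_structure (2 * m - 1) (sl (2 * m - 1)) q \<and>
             non_regular (2 * m - 1) (sl (2 * m - 1)) q"
  using complex_structure_frame_stabilizer[of m] non_regular_frame_stabilizer[OF assms] assms
  by auto

end
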